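(* Let $M$ be a finite set of prime numbers. If $x$ is an $M$-prime, then $K\cdot\prod_{p_i\in M}p_i + x$ is an $M$-prime for every integer $K$.
   Context: For a set $M$ of prime numbers, an $M$-prime is an integer not divisible by any of the primes in $M$. *)

theory Defs
  imports "HOL-Computational_Algebra.Primes"
begin

definition M_prime :: "int set \<Rightarrow> int \<Rightarrow> bool"
  where "M_prime M x \<longleftrightarrow> (\<forall>p\<in>M. \<not> p dvd x)"

end

theory Submission
  imports Defs
begin

text \<open>Each \<open>q\<close> in \<open>M\<close> is a factor of the product over
  \<open>M\<close>, hence divides its multiple by \<open>K\<close>. Adding that multiple to
  \<open>x\<close> keeps the residue modulo \<open>q\<close>, so \<open>q\<close> divides the sum
  exactly when it divides \<open>x\<close>.\<close>

theorem mainTheorem7: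
  fixes M :: "int set" and x :: int
  assumes "finite M" and "\<forall>p\<in>M. prime p"
    and "M_prime M x"
  shows "\<forall>K::int. M_prime M (K * (\<Prod>p\<in>M. p) + x)"
  unfolding M_prime_def
proof (intro allI ballI)
  fix K q :: int
  assume q: "q \<in> M"
  \<comment> \<open>Finiteness matters here: the product over an infinite set is 1 by convention,
    and no prime divides 1.\<close>
  with \<open>finite M\<close> have "q dvd (\<Prod>p\<in>M. p)"
    by (rule dvd_prodI)
  then have "q dvd K * (\<Prod>p\<in>M. p) + x \<longleftrightarrow> q dvd x"
    by (intro dvd_add_right_iff dvd_mult)
  with q \<open>M_prime M x\<close> show "\<not> q dvd K * (\<Prod>p\<in>M. p) + x"
    by (simp add: M_prime_def)
qed

end
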